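(* Consider triples of integers $(n,\alpha,k)$ satisfying $n\geq 2\alpha$, $n\geq\alpha+k$, $\alpha\geq 2$, $k\geq 3$. Call such a triple a counterexample if the formula $$f(n,\alpha,k)=\begin{cases}\left\lceil \dfrac{nk}{2}\right\rceil,&n\leq k\alpha,\\[6pt] t(n,\alpha)+\left\lceil\dfrac{k\alpha}{2}\right\rceil,&n>k\alpha\end{cases}$$ fails for it. Then the minimum possible order $n$ of a counterexample is seven. More precisely, $f(7,3,4)=15$, while the formula predicts $14$.
   Context: All graphs are finite, simple, and undirected. A graph is $k$-connected if it has more than $k$ vertices and deleting any set of fewer than $k$ vertices leaves a connected graph. The independence number of a graph is the maximum cardinality of a set of pairwise nonadjacent vertices. For integers $n,\alpha,k$ for which the class of $k$-connected graphs of order $n$ and independence number (exactly) $\alpha$ is nonempty, $f(n,\alpha,k)$ denotes the minimum number of edges of a graph in this class. If $n=q\alpha+r$ with $0\leq r<\alpha$, then $t(n,\alpha)=r\binom{q+1}{2}+(\alpha-r)\binom{q}{2}$, the number of edges of the disjoint union of $\alpha$ cliques of total order $n$ whose orders differ by at most one. *)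

theory Defs
  imports Complex_Main
begin

text \<open>A graph is given by its vertex set \<open>V\<close> and its set \<open>E\<close> of two-element edges.\<close>

definition simple_graph :: "'a set \<Rightarrow> 'a set set \<Rightarrow> bool" where
  "simple_graph V E \<longleftrightarrow> finite V \<and> (\<forall>e\<in>E. e \<subseteq> V \<and> card e = 2)"

definition connected_graph :: "'a set \<Rightarrow> 'a set set \<Rightarrow> bool" where
  "connected_graph V E \<longleftrightarrow> V \<noteq> {} \<and> (\<forall>u\<in>V. \<forall>v\<in>V. (u, v) \<in> {(x, y). {x, y} \<in> E}\<^sup>*)"

definition k_connected :: "nat \<Rightarrow> 'a set \<Rightarrow> 'a set set \<Rightarrow> bool" where
  "k_connected k V E \<longleftrightarrow> k < card V \<and>
     (\<forall>S\<subseteq>V. card S < k \<longrightarrow> connected_graph (V - S) {e \<in> E. e \<inter> S = {}})"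

definition independent_set :: "'a set \<Rightarrow> 'a set set \<Rightarrow> 'a set \<Rightarrow> bool" where
  "independent_set V E S \<longleftrightarrow> S \<subseteq> V \<and> (\<forall>u\<in>S. \<forall>v\<in>S. u \<noteq> v \<longrightarrow> {u, v} \<notin> E)"

definition independence_number :: "'a set \<Rightarrow> 'a set set \<Rightarrow> nat" where
  "independence_number V E = Max {card S | S. independent_set V E S}"

text \<open>Every finite graph is isomorphic to one whose vertices are natural numbers, so minimising
  over such graphs loses nothing.\<close>

definition graph_class :: "nat \<Rightarrow> nat \<Rightarrow> nat \<Rightarrow> (nat set \<times> nat set set) set" where
  "graph_class n \<alpha> k = {(V, E). simple_graph V E \<and> card V = n \<and>
     independence_number V E = \<alpha> \<and> k_connected k V E}"

text \<open>The minimum \<open>f(n,\<alpha>,k)\<close>. It is meaningful only when the class is nonempty, which holds for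
  all triples considered below by \<open>graph_class_nonempty\<close>.\<close>

definition min_edges :: "nat \<Rightarrow> nat \<Rightarrow> nat \<Rightarrow> nat" where
  "min_edges n \<alpha> k = (LEAST m. \<exists>(V, E) \<in> graph_class n \<alpha> k. card E = m)"

definition turan_t :: "nat \<Rightarrow> nat \<Rightarrow> nat" where
  "turan_t n \<alpha> = (let q = n div \<alpha>; r = n mod \<alpha>
     in r * ((q + 1) choose 2) + (\<alpha> - r) * (q choose 2))"

definition predicted_edges :: "nat \<Rightarrow> nat \<Rightarrow> nat \<Rightarrow> int" where
  "predicted_edges n \<alpha> k =
     (if n \<le> k * \<alpha> then \<lceil>real (n * k) / 2\<rceil>
      else int (turan_t n \<alpha>) + \<lceil>real (k * \<alpha>) / 2\<rceil>)"

text \<open>The bounds force all three integers to be positive, so triples of naturals suffice.\<close>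

definition admissible :: "nat \<Rightarrow> nat \<Rightarrow> nat \<Rightarrow> bool" where
  "admissible n \<alpha> k \<longleftrightarrow> n \<ge> 2 * \<alpha> \<and> n \<ge> \<alpha> + k \<and> \<alpha> \<ge> 2 \<and> k \<ge> 3"

definition counterexample :: "nat \<Rightarrow> nat \<Rightarrow> nat \<Rightarrow> bool" where
  "counterexample n \<alpha> k \<longleftrightarrow>
     admissible n \<alpha> k \<and> int (min_edges n \<alpha> k) \<noteq> predicted_edges n \<alpha> k"

text \<open>Witness: the join of \<open>\<alpha>\<close> isolated vertices with a complete graph on \<open>n - \<alpha>\<close> vertices.\<close>

lemma graph_class_nonempty:
  assumes "admissible n \<alpha> k"
  shows "graph_class n \<alpha> k \<noteq> {}"
proof -
  define V where "V = {..<n}"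
  define E where "E = {{u, v} | u v. u < n \<and> v < n \<and> u \<noteq> v \<and> \<alpha> \<le> v}"
  have bounds: "n \<ge> \<alpha> + k" "\<alpha> \<ge> 2" "k \<ge> 3"
    using assms by (auto simp: admissible_def)
  have edge: "{u, v} \<in> E" "{v, u} \<in> E" if "u < n" "v < n" "u \<noteq> v" "\<alpha> \<le> v" for u v
    using that unfolding E_def by (auto simp: insert_commute)
  have simple: "simple_graph V E"
    unfolding simple_graph_def V_def E_def by auto
  have indep_low: "independent_set V E {..<\<alpha>}"
    using bounds unfolding independent_set_def V_def E_def by (auto simp: doubleton_eq_iff)
  have indep_card: "card S \<le> \<alpha>" if S: "independent_set V E S" for S
  proof (cases "S \<subseteq> {..<\<alpha>}")
    case True
    then show ?thesis using card_mono[of "{..<\<alpha>}" S] by simp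
  next
    case False
    then obtain v where v: "v \<in> S" "\<alpha> \<le> v" by (meson lessThan_iff not_less subsetI)
    have "u = v" if "u \<in> S" for u
    proof (rule ccontr)
      assume "u \<noteq> v"
      moreover have "u < n" "v < n"
        using S v that unfolding independent_set_def V_def by auto
      ultimately have "{u, v} \<in> E" using edge v by blast
      then show False using S v that \<open>u \<noteq> v\<close> unfolding independent_set_def by blast
    qed
    then have "S \<subseteq> {v}" by blast
    then have "card S \<le> 1" using card_mono[of "{v}" S] by simp
    then show ?thesis using bounds by simp
  qed
  have alpha: "independence_number V E = \<alpha>"
    unfolding independence_number_def
  proof (rule Max_eqI)
    have "{card S | S. independent_set V E S} \<subseteq> {..\<alpha>}" using indep_card by auto
    then show "finite {card S | S. independent_set V E S}" by (rule finite_subset) simp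
    show "y \<le> \<alpha>" if "y \<in> {card S | S. independent_set V E S}" for y
      using that indep_card by auto
    show "\<alpha> \<in> {card S | S. independent_set V E S}"
      using indep_low by (auto intro!: exI[of _ "{..<\<alpha>}"])
  qed
  have conn: "connected_graph (V - S) {e \<in> E. e \<inter> S = {}}"
    if S: "S \<subseteq> V" "card S < k" for S
  proof -
    have "finite S" using S finite_subset unfolding V_def by blast
    have "\<not> {\<alpha>..<n} \<subseteq> S"
      using card_mono[OF \<open>finite S\<close>, of "{\<alpha>..<n}"] S bounds by auto
    then obtain w where w: "\<alpha> \<le> w" "w < n" "w \<notin> S" by (meson atLeastLessThan_iff subsetI)
    let ?R = "{(x, y). {x, y} \<in> {e \<in> E. e \<inter> S = {}}}"
    have "(u, w) \<in> ?R\<^sup>* \<and> (w, u) \<in> ?R\<^sup>*" if u: "u \<in> V - S" for u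
    proof (cases "u = w")
      case False
      then have "{u, w} \<in> E" "{w, u} \<in> E" using edge u w unfolding V_def by auto
      then have "(u, w) \<in> ?R" "(w, u) \<in> ?R" using u w by auto
      then show ?thesis by blast
    qed simp
    then have "\<forall>u\<in>V - S. \<forall>v\<in>V - S. (u, v) \<in> ?R\<^sup>*" by (meson rtrancl_trans)
    moreover have "V - S \<noteq> {}" using w unfolding V_def by auto
    ultimately show ?thesis unfolding connected_graph_def by simp
  qed
  have "k_connected k V E"
    using conn bounds unfolding k_connected_def by (auto simp: V_def)
  then have "(V, E) \<in> graph_class n \<alpha> k"
    using simple alpha unfolding graph_class_def by (simp add: V_def)
  then show ?thesis by blast
qed

end

theory Submission
  imports Defs
begin

text \<open>
  In a \<open>k\<close>-connected graph every degree is at least \<open>k\<close>, so there are at least \<open>nk/2\<close> edges. Up to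
  order six this bound is attained by complete multipartite graphs with parts of size \<open>\<alpha>\<close> (the last
  part may be smaller), except for \<open>(6,2,3)\<close>, where the triangular prism attains it.
  If \<open>(n,\<alpha>,k) = (7,3,4)\<close>, at least 12 edges meet an independent triple, and since
  deleting the triple leaves a connected graph on four vertices, there are at least three further
  edges. The graph \<open>K\<^bsub>1,3,3\<^esub>\<close> has exactly 15 edges.
\<close>

section \<open>Degrees in k-connected graphs\<close>

lemma finite_edges: "simple_graph V E \<Longrightarrow> finite E"
  by (rule finite_subset[of _ "Pow V"]) (auto simp: simple_graph_def)

lemma edgeD:
  assumes "simple_graph V E" "{u, v} \<in> E"
  shows "u \<in> V" "v \<in> V" "u \<noteq> v"
proof -
  have "{u, v} \<subseteq> V" "card {u, v} = 2"
    using assms unfolding simple_graph_def by blast+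
  then show "u \<in> V" "v \<in> V" "u \<noteq> v" by auto
qed

lemma sum_degrees:
  assumes "simple_graph V E"
  shows "(\<Sum>v\<in>V. card {e \<in> E. v \<in> e}) = 2 * card E"
proof (rule sum_multicount)
  show "\<forall>e\<in>E. card {v \<in> V. v \<in> e} = 2"
  proof
    fix e assume "e \<in> E"
    then have "{v \<in> V. v \<in> e} = e" "card e = 2"
      using assms by (auto simp: simple_graph_def)
    then show "card {v \<in> V. v \<in> e} = 2" by simp
  qed
qed (use assms finite_edges in \<open>auto simp: simple_graph_def\<close>)

text \<open>Otherwise the neighbourhood \<open>N\<close> of \<open>v\<close> has fewer than
  \<open>k\<close> vertices, yet deleting it cuts \<open>v\<close> off from a remaining
  vertex.\<close>

lemma k_connected_degree:
  assumes simple: "simple_graph V E" and conn: "k_connected k V E" and "v \<in> V"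
  shows "k \<le> card {e \<in> E. v \<in> e}"
proof (rule ccontr)
  assume low: "\<not> k \<le> card {e \<in> E. v \<in> e}"
  define N where "N = {u. {v, u} \<in> E}"
  have N: "N \<subseteq> V" "v \<notin> N" using edgeD[OF simple] unfolding N_def by blast+
  have finV: "finite V" using simple by (simp add: simple_graph_def)
  have "card N \<le> card {e \<in> E. v \<in> e}"
  proof (rule card_inj_on_le)
    show "inj_on (\<lambda>u. {v, u}) N" by (auto simp: inj_on_def doubleton_eq_iff)
  qed (use finite_edges[OF simple] in \<open>auto simp: N_def\<close>)
  then have small: "card N < k" using low by simp
  \<comment> \<open>\<open>N\<close> together with \<open>v\<close> has at most \<open>k\<close>
    vertices; the clause \<open>k < card V\<close> thus leaves a further vertex
    \<open>w\<close>.\<close>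
  have "card (insert v N) < card V"
    using small conn N finite_subset[OF _ finV] by (auto simp: k_connected_def)
  then have "\<not> V \<subseteq> insert v N"
    using card_mono[of "insert v N" V] N finite_subset[OF _ finV] by fastforce
  then obtain w where w: "w \<in> V" "w \<notin> N" "w \<noteq> v" by blast
  have "connected_graph (V - N) {e \<in> E. e \<inter> N = {}}"
    using conn small N by (auto simp: k_connected_def)
  then have "(v, w) \<in> {(x, y). {x, y} \<in> {e \<in> E. e \<inter> N = {}}}\<^sup>*"
    using w N \<open>v \<in> V\<close> by (auto simp: connected_graph_def)
  \<comment> \<open>The first step of a walk from \<open>v\<close> to \<open>w\<close> would use an
    edge from \<open>v\<close> to a vertex of \<open>N\<close>, and such edges are deleted.\<close>
  then show False
    by (cases rule: converse_rtranclE) (use w in \<open>auto simp: N_def\<close>)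
qed

lemma k_connected_edges:
  assumes "simple_graph V E" "k_connected k V E"
  shows "card V * k \<le> 2 * card E"
proof -
  have "card V * k \<le> (\<Sum>v\<in>V. card {e \<in> E. v \<in> e})"
    using sum_bounded_below[of V k "\<lambda>v. card {e \<in> E. v \<in> e}"] k_connected_degree[OF assms]
    by simp
  then show ?thesis using sum_degrees[OF assms(1)] by simp
qed

section \<open>Edges of connected graphs and edges meeting an independent set\<close>

lemma rtrancl_leaves:
  assumes "(u, v) \<in> r\<^sup>*" "u \<in> S" "v \<notin> S"
  obtains x y where "(x, y) \<in> r" "x \<in> S" "y \<notin> S"
  using assms by (induction arbitrary: thesis rule: rtrancl_induct) blast+

text \<open>Grow a set \<open>S\<close> from one vertex: while \<open>S\<close> misses a vertex,
  some edge leaves \<open>S\<close>, and adding its outer end gains one vertex and at least one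
  inner edge.\<close>

lemma connected_graph_edges:
  assumes conn: "connected_graph V E" and V: "finite V" and E: "finite E"
    and sub: "\<forall>e\<in>E. e \<subseteq> V"
  shows "card V \<le> card E + 1"
proof -
  have "\<exists>S. S \<subseteq> V \<and> card S = Suc m \<and> m \<le> card {e \<in> E. e \<subseteq> S}" if "Suc m \<le> card V" for m
    using that
  proof (induction m)
    case 0
    obtain v where "v \<in> V" using conn by (auto simp: connected_graph_def)
    then show ?case by (intro exI[of _ "{v}"]) simp
  next
    case (Suc m)
    then obtain S where S: "S \<subseteq> V" "card S = Suc m" "m \<le> card {e \<in> E. e \<subseteq> S}" by auto
    have finS: "finite S" using S V finite_subset by blast
    obtain u where u: "u \<in> S" using S by fastforce
    have "\<not> V \<subseteq> S" using card_mono[OF finS, of V] S Suc.prems by auto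
    then obtain v where v: "v \<in> V" "v \<notin> S" by blast
    have "(u, v) \<in> {(x, y). {x, y} \<in> E}\<^sup>*"
      using conn u v S by (auto simp: connected_graph_def)
    then obtain x y where xy: "{x, y} \<in> E" "x \<in> S" "y \<notin> S"
      using u v(2) by (rule rtrancl_leaves) simp
    have "insert {x, y} {e \<in> E. e \<subseteq> S} \<subseteq> {e \<in> E. e \<subseteq> insert y S}"
      using xy by auto
    then have "card (insert {x, y} {e \<in> E. e \<subseteq> S}) \<le> card {e \<in> E. e \<subseteq> insert y S}"
      using E by (intro card_mono) auto
    then have "Suc m \<le> card {e \<in> E. e \<subseteq> insert y S}"
      using S xy E by simp
    moreover have "insert y S \<subseteq> V" using xy sub S by blast
    moreover have "card (insert y S) = Suc (Suc m)" using xy S finS by simp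
    ultimately show ?case by blast
  qed
  \<comment> \<open>A connected graph has a vertex, so this subtraction is not truncated.\<close>
  from this[of "card V - 1"] obtain S
    where "card V - 1 \<le> card {e \<in> E. e \<subseteq> S}"
    using conn V by (auto simp: connected_graph_def card_gt_0_iff Suc_le_eq)
  moreover have "card {e \<in> E. e \<subseteq> S} \<le> card E" using E by (intro card_mono) auto
  ultimately show ?thesis by simp
qed

text \<open>At least \<open>k |I|\<close> edges meet \<open>I\<close>, and a spanning tree of the rest has \<open>|V| - |I| - 1\<close> edges; the
  terms are moved so that no subtraction occurs.\<close>

lemma k_connected_independent_edges:
  assumes simple: "simple_graph V E" and conn: "k_connected k V E"
    and I: "independent_set V E I" and small: "card I < k"
  shows "k * card I + card V \<le> card E + card I + 1"
proof -
  have finV: "finite V" and finE: "finite E"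
    using simple finite_edges by (auto simp: simple_graph_def)
  have IV: "I \<subseteq> V" and finI: "finite I"
    using I finV finite_subset by (auto simp: independent_set_def)
  \<comment> \<open>Independence makes the sets of edges at distinct vertices of \<open>I\<close>
    disjoint, so the degrees add up without double counting.\<close>
  have disj: "{e \<in> E. u \<in> e} \<inter> {e \<in> E. v \<in> e} = {}" if "u \<in> I" "v \<in> I" "u \<noteq> v" for u v
  proof -
    have "e = {u, v}" if "e \<in> E" "u \<in> e" "v \<in> e" for e
    proof -
      have "card e = 2" using that simple by (auto simp: simple_graph_def)
      then show ?thesis using that \<open>u \<noteq> v\<close> by (auto simp: card_2_iff)
    qed
    then show ?thesis using I that by (auto simp: independent_set_def)
  qed
  have "k * card I \<le> (\<Sum>v\<in>I. card {e \<in> E. v \<in> e})"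
    using sum_bounded_below[of I k "\<lambda>v. card {e \<in> E. v \<in> e}"]
      k_connected_degree[OF simple conn] IV by (auto simp: mult.commute)
  also have "\<dots> = card (\<Union>v\<in>I. {e \<in> E. v \<in> e})"
    using finI finE disj by (intro card_UN_disjoint[symmetric]) auto
  also have "(\<Union>v\<in>I. {e \<in> E. v \<in> e}) = {e \<in> E. e \<inter> I \<noteq> {}}" by auto
  finally have meet: "k * card I \<le> card {e \<in> E. e \<inter> I \<noteq> {}}" .
  have "card (V - I) \<le> card {e \<in> E. e \<inter> I = {}} + 1"
  proof (rule connected_graph_edges)
    show "connected_graph (V - I) {e \<in> E. e \<inter> I = {}}"
      using conn IV small by (auto simp: k_connected_def)
    show "\<forall>e\<in>{e \<in> E. e \<inter> I = {}}. e \<subseteq> V - I"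
      using simple by (auto simp: simple_graph_def)
  qed (use finV finE in auto)
  moreover have "card V = card (V - I) + card I"
    using IV finI finV card_mono[OF finV IV] by (simp add: card_Diff_subset)
  moreover have "card E = card {e \<in> E. e \<inter> I \<noteq> {}} + card {e \<in> E. e \<inter> I = {}}"
    using finE by (subst card_Un_disjoint[symmetric]) (auto intro: arg_cong[where f = card])
  ultimately show ?thesis using meet by simp
qed

section \<open>Computing the independence number and the minimum\<close>

lemma independence_number_eqI:
  assumes S: "independent_set V E S" and max: "\<And>T. independent_set V E T \<Longrightarrow> card T \<le> card S"
  shows "independence_number V E = card S"
  unfolding independence_number_def
proof (rule Max_eqI)
  show "finite {card T |T. independent_set V E T}"
    by (rule finite_subset[of _ "{..card S}"]) (use max in auto)
qed (use assms in auto)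

lemma independence_number_attained:
  assumes "simple_graph V E"
  obtains I where "independent_set V E I" "card I = independence_number V E"
proof -
  let ?C = "{card S |S. independent_set V E S}"
  have "?C \<subseteq> card ` Pow V" by (auto simp: independent_set_def)
  then have "finite ?C"
    by (rule finite_subset) (use assms in \<open>auto simp: simple_graph_def\<close>)
  moreover have "independent_set V E {}" by (simp add: independent_set_def)
  then have "?C \<noteq> {}" by blast
  ultimately have "Max ?C \<in> ?C" by (rule Max_in)
  then show thesis using that unfolding independence_number_def by auto
qed

lemma min_edges_eqI:
  assumes "(V, E) \<in> graph_class n \<alpha> k"
    and "\<And>V' E'. (V', E') \<in> graph_class n \<alpha> k \<Longrightarrow> card E \<le> card E'"
  shows "min_edges n \<alpha> k = card E"
  unfolding min_edges_def by (rule Least_equality) (use assms in blast)+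

section \<open>Complete multipartite graphs\<close>

text \<open>For positive \<open>a\<close> the parts are blocks of \<open>a\<close> consecutive
  numbers, the last possibly shorter, and \<open>v div a\<close> is the index of the part of
  \<open>v\<close>.\<close>

definition multipartite_edges :: "nat \<Rightarrow> nat \<Rightarrow> nat set set" where
  "multipartite_edges n a = {{u, v} | u v. u < n \<and> v < n \<and> u div a \<noteq> v div a}"

lemma multipartite_edge_iff:
  "{u, v} \<in> multipartite_edges n a \<longleftrightarrow> u < n \<and> v < n \<and> u div a \<noteq> v div a"
  unfolding multipartite_edges_def by (auto simp: doubleton_eq_iff)

text \<open>Count each edge at its larger end \<open>v\<close>: the smaller neighbours of
  \<open>v\<close> are the numbers below the start \<open>v div a * a\<close> of its block.\<close>

lemma card_multipartite_edges:
  assumes "0 < a"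
  shows "card (multipartite_edges n a) = (\<Sum>v<n. v div a * a)"
proof -
  let ?P = "SIGMA v:{..<n}. {..<v div a * a}"
  have less: "u < v div a * a \<longleftrightarrow> u div a < v div a" for u v :: nat
    using assms by (simp add: div_less_iff_less_mult)
  have lt: "u < v" if "u div a < v div a" for u v :: nat
    using that div_le_mono[of v u a] by (meson leD not_le_imp_less)
  have "multipartite_edges n a = (\<lambda>(v, u). {u, v}) ` ?P"
  proof (intro equalityI subsetI)
    fix e assume "e \<in> multipartite_edges n a"
    then obtain u v where uv: "e = {u, v}" "u < n" "v < n" "u div a \<noteq> v div a"
      by (auto simp: multipartite_edges_def)
    then consider "u div a < v div a" | "v div a < u div a" by linarith
    then show "e \<in> (\<lambda>(v, u). {u, v}) ` ?P"
    proof cases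
      case 1
      then show ?thesis using uv by (intro image_eqI[of _ _ "(v, u)"]) (auto simp: less)
    next
      case 2
      then show ?thesis using uv by (intro image_eqI[of _ _ "(u, v)"]) (auto simp: less)
    qed
  next
    fix e assume "e \<in> (\<lambda>(v, u). {u, v}) ` ?P"
    then obtain u v where "e = {u, v}" "v < n" "u div a < v div a" by (auto simp: less)
    then show "e \<in> multipartite_edges n a"
      using lt[of u v] by (auto simp: multipartite_edge_iff)
  qed
  moreover have "inj_on (\<lambda>(v, u). {u, v}) ?P"
    by (auto simp: inj_on_def doubleton_eq_iff less dest: lt)
  ultimately have "card (multipartite_edges n a) = card ?P" by (simp add: card_image)
  then show ?thesis by simp
qed

text \<open>An independent set stays within one part, and the first part is full. Vertices in
  different parts are adjacent; two in the same part are joined through a surviving vertex of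
  another part.\<close>

lemma multipartite_in_graph_class:
  assumes "0 < a" "0 < k" "a + k \<le> n"
  shows "({..<n}, multipartite_edges n a) \<in> graph_class n a k"
proof -
  let ?V = "{..<n}" and ?E = "multipartite_edges n a"
  have part: "T \<subseteq> {i * a..<i * a + a}" if "\<And>u. u \<in> T \<Longrightarrow> u div a = i" for T and i :: nat
  proof
    fix u assume "u \<in> T"
    then have "i = u div a" using that by simp
    then show "u \<in> {i * a..<i * a + a}"
      using dividend_less_div_times[OF \<open>0 < a\<close>, of u] by simp
  qed
  have part_card: "card T \<le> a" if "\<And>u. u \<in> T \<Longrightarrow> u div a = i" for T and i :: nat
    using card_mono[OF _ part[OF that]] by simp
  have simple: "simple_graph ?V ?E"
    by (auto simp: simple_graph_def multipartite_edges_def card_2_iff)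
  have "independent_set ?V ?E {..<a}"
    using assms by (auto simp: independent_set_def multipartite_edge_iff)
  moreover have "card T \<le> card {..<a}" if T: "independent_set ?V ?E T" for T
  proof (cases "T = {}")
    case False
    then obtain v where "v \<in> T" by blast
    have "u div a = v div a" if "u \<in> T" for u
    proof (rule ccontr)
      assume "u div a \<noteq> v div a"
      moreover have "u < n" "v < n" using T \<open>u \<in> T\<close> \<open>v \<in> T\<close> by (auto simp: independent_set_def)
      ultimately have "{u, v} \<in> ?E" "u \<noteq> v" by (auto simp: multipartite_edge_iff)
      then show False using T \<open>u \<in> T\<close> \<open>v \<in> T\<close> by (simp add: independent_set_def)
    qed
    then have "card T \<le> a" by (rule part_card)
    then show ?thesis by simp
  qed simp
  ultimately have alpha: "independence_number ?V ?E = a"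
    using independence_number_eqI by (metis card_lessThan)
  have conn: "connected_graph (?V - S) {e \<in> ?E. e \<inter> S = {}}" if S: "S \<subseteq> ?V" "card S < k" for S
  proof -
    let ?R = "{(x, y). {x, y} \<in> {e \<in> ?E. e \<inter> S = {}}}"
    have finS: "finite S" using S finite_subset by blast
    \<comment> \<open>More than \<open>n - k\<close> vertices survive, hence more than
      \<open>a\<close>, so they do not fit into one part.\<close>
    have other: "\<exists>w\<in>?V - S. w div a \<noteq> i" for i
    proof (rule ccontr)
      assume "\<not> ?thesis"
      then have "card (?V - S) \<le> a" by (intro part_card) auto
      moreover have "card (?V - S) = n - card S"
        using S finS by (simp add: card_Diff_subset)
      ultimately show False using S assms by linarith
    qed
    have edge: "(u, v) \<in> ?R" if "u \<in> ?V - S" "v \<in> ?V - S" "u div a \<noteq> v div a" for u v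
      using that by (auto simp: multipartite_edge_iff)
    have "(u, v) \<in> ?R\<^sup>*" if uv: "u \<in> ?V - S" "v \<in> ?V - S" for u v
    proof (cases "u div a = v div a")
      case True
      obtain w where "w \<in> ?V - S" "w div a \<noteq> u div a" using other by blast
      then have "(u, w) \<in> ?R" "(w, v) \<in> ?R"
        using edge[of u w] edge[of w v] uv True by fastforce+
      then show ?thesis by (meson converse_rtrancl_into_rtrancl r_into_rtrancl)
    next
      case False
      then show ?thesis using edge uv by blast
    qed
    moreover have "?V - S \<noteq> {}" using other by blast
    ultimately show ?thesis by (simp add: connected_graph_def)
  qed
  then show ?thesis
    using simple alpha assms by (auto simp: graph_class_def k_connected_def)
qed

section \<open>The triangular prism\<close>

text \<open>The triangles of the prism are the fibres of \<open>v div 3\<close>; the three rungs are the fibres of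
  \<open>v mod 3\<close>.\<close>

definition prism_edges :: "nat set set" where
  "prism_edges = {{0, 1}, {0, 2}, {1, 2}, {3, 4}, {3, 5}, {4, 5}, {0, 3}, {1, 4}, {2, 5}}"

lemma prism_edge:
  assumes "u < 6" "v < 6" "u \<noteq> v" "u div 3 = v div 3 \<or> u mod 3 = v mod 3"
  shows "{u, v} \<in> prism_edges"
proof -
  have "\<forall>u\<in>{..<6}. \<forall>v\<in>{..<6}. u \<noteq> v \<longrightarrow> u div 3 = v div 3 \<or> u mod 3 = v mod 3 \<longrightarrow>
      {u, v} \<in> prism_edges"
    by (simp add: lessThan_nat_numeral prism_edges_def doubleton_eq_iff)
  then show ?thesis using assms by blast
qed

lemma card_prism_edges: "card prism_edges = 9"
  by (simp add: prism_edges_def doubleton_eq_iff)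

lemma prism_in_graph_class: "({..<6}, prism_edges) \<in> graph_class 6 2 3"
proof -
  let ?V = "{..<6::nat}" and ?E = prism_edges
  have simple: "simple_graph ?V ?E" by (auto simp: simple_graph_def prism_edges_def)
  \<comment> \<open>The vertices 0 and 4 lie in different triangles and on different rungs.\<close>
  have "independent_set ?V ?E {0, 4}"
    by (auto simp: independent_set_def prism_edges_def doubleton_eq_iff)
  moreover have "card T \<le> card {0, 4::nat}" if T: "independent_set ?V ?E T" for T
  proof -
    \<comment> \<open>An independent set has at most one vertex in each of the two
      triangles.\<close>
    have "inj_on (\<lambda>u. u div 3) T"
      unfolding inj_on_def
      using T prism_edge by (metis independent_set_def lessThan_iff subsetD)
    moreover have "(\<lambda>u. u div 3) ` T \<subseteq> {..<2}"
      using T by (auto simp: independent_set_def)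
    ultimately have "card T \<le> card {..<2::nat}" by (intro card_inj_on_le) auto
    then show ?thesis by simp
  qed
  ultimately have alpha: "independence_number ?V ?E = 2"
    using independence_number_eqI[of ?V ?E "{0, 4}"] by simp
  have conn: "connected_graph (?V - S) {e \<in> ?E. e \<inter> S = {}}" if S: "S \<subseteq> ?V" "card S < 3" for S
  proof -
    let ?R = "{(x, y). {x, y} \<in> {e \<in> ?E. e \<inter> S = {}}}"
    have finS: "finite S" using S finite_subset by blast
    text \<open>One of the three rungs avoids \<open>S\<close>; every remaining vertex reaches it within its triangle.\<close>
    have "card ((\<lambda>u. u mod 3) ` S) < card {..<3::nat}"
      using card_image_le[OF finS, of "\<lambda>u. u mod 3"] S by simp
    then have "\<not> {..<3} \<subseteq> (\<lambda>u. u mod 3) ` S"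
      using card_mono[of "(\<lambda>u. u mod 3) ` S" "{..<3::nat}"] finS by fastforce
    then obtain j where j: "j < 3" "j \<notin> (\<lambda>u. u mod 3) ` S" by blast
    have avoid: "3 * i + j \<notin> S" for i
      using j image_eqI[of j "\<lambda>u. u mod 3" "3 * i + j" S] by auto
    have step: "(u, v) \<in> ?R\<^sup>*"
      if "u \<in> ?V - S" "v \<in> ?V - S" "u div 3 = v div 3 \<or> u mod 3 = v mod 3" for u v
      using that prism_edge[of u v] by (cases "u = v") auto
    have "(u, v) \<in> ?R\<^sup>*" if uv: "u \<in> ?V - S" "v \<in> ?V - S" for u v
    proof -
      \<comment> \<open>These are the ends of the surviving rung \<open>j\<close> in the triangles
        of \<open>u\<close> and \<open>v\<close>. The walk enters the rung at \<open>?a\<close> and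
        leaves it at \<open>?b\<close>.\<close>
      let ?a = "3 * (u div 3) + j" and ?b = "3 * (v div 3) + j"
      have ab: "?a \<in> ?V - S" "?b \<in> ?V - S"
        using avoid uv j less_mult_imp_div_less[of u 2 3] less_mult_imp_div_less[of v 2 3] by auto
      have "(u, ?a) \<in> ?R\<^sup>*" "(?a, ?b) \<in> ?R\<^sup>*" "(?b, v) \<in> ?R\<^sup>*"
        using j by (intro step uv ab; simp)+
      then show ?thesis by (meson rtrancl_trans)
    qed
    moreover have "j \<in> ?V - S" using avoid[of 0] j by simp
    then have "?V - S \<noteq> {}" by blast
    ultimately show ?thesis by (simp add: connected_graph_def)
  qed
  then show ?thesis
    using simple alpha by (auto simp: graph_class_def k_connected_def)
qed

section \<open>Minimum edge counts for the small triples\<close>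

lemma graph_class_edges:
  assumes "(V, E) \<in> graph_class n \<alpha> k"
  shows "n * k \<le> 2 * card E"
  using assms k_connected_edges by (auto simp: graph_class_def)

text \<open>The \<open>+ 1\<close> allows for odd \<open>n * k\<close>, where the degree bound
  rounds up.\<close>

lemma min_edges_eq_half:
  assumes "(V, E) \<in> graph_class n \<alpha> k" "2 * card E \<le> n * k + 1"
  shows "min_edges n \<alpha> k = card E"
proof (rule min_edges_eqI[OF assms(1)])
  fix V' E' assume "(V', E') \<in> graph_class n \<alpha> k"
  then have "n * k \<le> 2 * card E'" by (rule graph_class_edges)
  then show "card E \<le> card E'" using assms(2) by linarith
qed

text \<open>The parts have sizes 2, 2, 1, which gives the wheel with four spokes; 15 is odd, so 8
  edges are optimal.\<close>

lemma min_edges_5_2_3: "min_edges 5 2 3 = 8"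
  using min_edges_eq_half[OF multipartite_in_graph_class[of 2 3 5]]
  by (simp add: card_multipartite_edges lessThan_nat_numeral)

lemma min_edges_6_2_3: "min_edges 6 2 3 = 9"
  using min_edges_eq_half[OF prism_in_graph_class] by (simp add: card_prism_edges)

text \<open>Three parts of size 2 form the octahedron, which is 4-regular.\<close>

lemma min_edges_6_2_4: "min_edges 6 2 4 = 12"
  using min_edges_eq_half[OF multipartite_in_graph_class[of 2 4 6]]
  by (simp add: card_multipartite_edges lessThan_nat_numeral)

lemma min_edges_6_3_3: "min_edges 6 3 3 = 9"
  using min_edges_eq_half[OF multipartite_in_graph_class[of 3 3 6]]
  by (simp add: card_multipartite_edges lessThan_nat_numeral)

lemma min_edges_7_3_4: "min_edges 7 3 4 = 15"
proof -
  have card: "card (multipartite_edges 7 3) = 15"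
    by (simp add: card_multipartite_edges lessThan_nat_numeral)
  have "min_edges 7 3 4 = card (multipartite_edges 7 3)"
  proof (rule min_edges_eqI)
    show "({..<7}, multipartite_edges 7 3) \<in> graph_class 7 3 4"
      by (rule multipartite_in_graph_class) auto
    fix V and E :: "nat set set"
    assume "(V, E) \<in> graph_class 7 3 4"
    then have G: "simple_graph V E" "card V = 7" "independence_number V E = 3" "k_connected 4 V E"
      by (auto simp: graph_class_def)
    obtain I where "independent_set V E I" "card I = 3"
      using independence_number_attained[OF G(1)] G(3) by metis
    \<comment> \<open>The bound reads \<open>4 * 3 + 7 \<le> card E + 3 + 1\<close>, that is,
      \<open>15 \<le> card E\<close>.\<close>
    then show "card (multipartite_edges 7 3) \<le> card E"
      using k_connected_independent_edges[OF G(1,4)] G(2) card by fastforce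
  qed
  then show ?thesis by (simp add: card)
qed

text \<open>Here \<open>n \<ge> \<alpha> + k \<ge> 5\<close>,
  \<open>2 * \<alpha> \<le> n \<le> 6\<close> and \<open>k \<le> n - \<alpha> \<le> 4\<close>, which
  leaves finitely many cases.\<close>

lemma admissible_below_7:
  assumes "admissible n \<alpha> k" "n < 7"
  shows "(n, \<alpha>, k) \<in> {(5, 2, 3), (6, 2, 3), (6, 2, 4), (6, 3, 3)}"
proof -
  have "\<alpha> = 2 \<or> \<alpha> = 3" "k = 3 \<or> k = 4" "n = 5 \<or> n = 6"
    using assms unfolding admissible_def by linarith+
  then show ?thesis using assms unfolding admissible_def by auto
qed

theorem proposition4p1:
  shows "(\<exists>\<alpha> k. counterexample 7 \<alpha> k) \<and>
    (\<forall>n \<alpha> k. counterexample n \<alpha> k \<longrightarrow> 7 \<le> n) \<and>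
    counterexample 7 3 4 \<and>
    min_edges 7 3 4 = 15 \<and>
    predicted_edges 7 3 4 = 14"
proof -
  \<comment> \<open>Since \<open>7 \<le> 4 * 3\<close>, the first case of the formula
    applies.\<close>
  have pred: "predicted_edges 7 3 4 = 14" by (simp add: predicted_edges_def)
  have ce: "counterexample 7 3 4"
    by (simp add: counterexample_def admissible_def min_edges_7_3_4 pred)
  have "7 \<le> n" if "counterexample n \<alpha> k" for n \<alpha> k
  proof (rule ccontr)
    assume "\<not> 7 \<le> n"
    then have "(n, \<alpha>, k) \<in> {(5, 2, 3), (6, 2, 3), (6, 2, 4), (6, 3, 3)}"
      using that admissible_below_7 by (auto simp: counterexample_def)
    \<comment> \<open>All four triples satisfy \<open>n \<le> 6 \<le> k * \<alpha>\<close>, so the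
      prediction is half of \<open>n * k\<close>, rounded up.\<close>
    then have "int (min_edges n \<alpha> k) = predicted_edges n \<alpha> k"
      by (auto simp: predicted_edges_def min_edges_5_2_3 min_edges_6_2_3 min_edges_6_2_4
          min_edges_6_3_3)
    then show False using that by (simp add: counterexample_def)
  qed
  then show ?thesis using ce pred min_edges_7_3_4 by blast
qed

end
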